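(* Let $\mathcal{P}$ and $\mathcal{Q}$ be a pair of compactness-like topological properties. Let $X$ be a Tychonoff space with $\mathcal{Q}$. Then (1) $\mathscr{O}^{\mathcal Q}_{\mathcal P}(X)=\{Y: Y\text{ is maximal in }(\mathscr{E}^{\mathcal Q}_{\mathcal P}(X),\le_{inj})\}$. (2) $\mathscr{O}^{\mathcal Q}_{\mathcal P}(X)$ is the smallest (with respect to inclusion) cofinal subset of $(\mathscr{E}^{\mathcal Q}_{\mathcal P}(X),\le_{inj})$. (3) $\mathscr{O}^{\mathcal Q}_{\mathcal P}(X)$ is the unique cofinal subset of $(\mathscr{E}^{\mathcal Q}_{\mathcal P}(X),\le_{inj})$ on which the two relations $\le_{inj}$ and $=$ coincide. (4) $\mathscr{O}^{\mathcal Q}_{\mathcal P}(X)$ is the largest (with respect to inclusion) subset $\mathscr E$ of $\mathscr{E}^{\mathcal Q}_{\mathcal P}(X)$ such that for all $S\in\mathscr E$ and $T\in\mathscr{E}^{\mathcal Q}_{\mathcal P}(X)$, $S\le_{inj}T$ implies $S=T$.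
   Context: Conventions: compact spaces and Tychonoff spaces are Hausdorff. Topological properties are assumed to be satisfied by at least one space. A mapping $f:X\to Y$ is perfect if $X$ is Hausdorff and $f$ is continuous, closed (not necessarily surjective) and has compact fibers. A topological property $\mathcal{P}$ is invariant (inverse invariant) under perfect mappings if for every perfect surjective $f:X\to Y$, $Y$ has $\mathcal P$ whenever $X$ does ($X$ has $\mathcal P$ whenever $Y$ does); it is perfect if both hold. $\mathcal P$ is clopen hereditary if every clopen subset of a space with $\mathcal P$ has $\mathcal P$; finitely additive if $X_1\oplus\cdots\oplus X_n$ has $\mathcal P$ whenever every $X_i$ does. $\mathcal P$ satisfies Mrówka's condition (W) if: whenever $X$ is a Tychonoff space having a point $p$ with an open base $\mathscr B$ for $X$ at $p$ such that $X\setminus B$ has $\mathcal P$ for every $B\in\mathscr B$, then $X$ has $\mathcal P$. $\mathcal P$ is compactness-like if it is clopen hereditary, finitely additive, perfect and satisfies (W). "$\mathcal P$ and $\mathcal Q$ is a pair of compactness-like topological properties" (order matters) means: $\mathcal P$ is compactness-like, and $\mathcal Q$ is clopen hereditary, inverse invariant under perfect mappings and satisfies (W). A space $Y$ is an extension of $X$ if it contains $X$ as a dense subspace; $Y\setminus X$ is its remainder. Extensions are identified (considered equal) when there is a homeomorphism between them fixing $X$ pointwise. $Y\le_{inj}Y'$ means there is a continuous injective map $Y'\to Y$ fixing $X$ pointwise. $\mathscr E(X)$ is the set of all Tychonoff extensions of $X$ with compact remainder; $\mathscr E_{\mathcal P}(X)=\mathscr E^{\mathcal P}(X)$ is the set of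 elements of $\mathscr E(X)$ having $\mathcal P$; $\mathscr E^{\mathcal Q}_{\mathcal P}(X)=\mathscr E^{\mathcal Q}(X)\cap\mathscr E_{\mathcal P}(X)$. A minimal $\mathcal P$-extension of $X$ is a $Y\in\mathscr E_{\mathcal P}(X)$ which does not properly contain (as a subspace) any other element of $\mathscr E_{\mathcal P}(X)$. An optimal $\mathcal P$-extension of $X$ is a minimal $\mathcal P$-extension $Y$ whose topology is moreover maximal (with respect to inclusion) among all topologies on the set $Y$ which turn $Y$ into an element of $\mathscr E_{\mathcal P}(X)$. $\mathscr O_{\mathcal P}(X)$ is the set of optimal $\mathcal P$-extensions and $\mathscr O^{\mathcal Q}_{\mathcal P}(X)=\mathscr E^{\mathcal Q}(X)\cap\mathscr O_{\mathcal P}(X)$. A subset $A$ of a partially ordered set $(L,\le)$ is cofinal if for any $x\in L$ there is $a\in A$ with $x\le a$. *)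

theory Defs
  imports "HOL-Analysis.Analysis"
begin

text \<open>
  HOL cannot quantify over all spaces, so all spaces considered are topologies on sets of points
  of one arbitrary type \<open>'u\<close>. A topological property is a homeomorphism-invariant
  predicate on \<open>'u topology\<close>, and the extensions of \<open>X\<close> are those carried by sets
  of type \<open>'u set\<close>. A Hausdorff extension of \<open>X\<close> has at most
  $2^{2^{|X|}}$ points, so once \<open>'u\<close> has that many points outside \<open>X\<close>, every
  Tychonoff extension of \<open>X\<close> occurs up to a homeomorphism fixing \<open>X\<close> pointwise.
\<close>

definition Tychonoff_space :: "'u topology \<Rightarrow> bool" where
  "Tychonoff_space X \<longleftrightarrow> completely_regular_space X \<and> Hausdorff_space X"

definition perfect_mapping :: "'u topology \<Rightarrow> 'v topology \<Rightarrow> ('u \<Rightarrow> 'v) \<Rightarrow> bool" where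
  "perfect_mapping X Y f \<longleftrightarrow> Hausdorff_space X \<and> continuous_map X Y f \<and> proper_map X Y f"

subsection \<open>Topological properties\<close>

definition topological_property :: "('u topology \<Rightarrow> bool) \<Rightarrow> bool" where
  "topological_property P \<longleftrightarrow>
     (\<exists>X. P X) \<and> (\<forall>X Y. X homeomorphic_space Y \<longrightarrow> P X \<longrightarrow> P Y)"

definition perfect_invariant :: "('u topology \<Rightarrow> bool) \<Rightarrow> bool" where
  "perfect_invariant P \<longleftrightarrow>
     (\<forall>X Y f. perfect_mapping X Y f \<and> f ` topspace X = topspace Y \<longrightarrow> P X \<longrightarrow> P Y)"

definition perfect_inverse_invariant :: "('u topology \<Rightarrow> bool) \<Rightarrow> bool" where
  "perfect_inverse_invariant P \<longleftrightarrow>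
     (\<forall>X Y f. perfect_mapping X Y f \<and> f ` topspace X = topspace Y \<longrightarrow> P Y \<longrightarrow> P X)"

definition perfect_property :: "('u topology \<Rightarrow> bool) \<Rightarrow> bool" where
  "perfect_property P \<longleftrightarrow> perfect_invariant P \<and> perfect_inverse_invariant P"

definition clopen_hereditary :: "('u topology \<Rightarrow> bool) \<Rightarrow> bool" where
  "clopen_hereditary P \<longleftrightarrow>
     (\<forall>X C. P X \<and> openin X C \<and> closedin X C \<longrightarrow> P (subtopology X C))"

text \<open>The points of \<^term>\<open>sum_topology Xs I\<close> are pairs, so the property is
  evaluated at the copies of the sum carried by the type \<open>'u\<close>.\<close>

definition finitely_additive :: "('u topology \<Rightarrow> bool) \<Rightarrow> bool" where
  "finitely_additive P \<longleftrightarrow>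
     (\<forall>(n::nat) Xs Z. 1 \<le> n \<and> (\<forall>i\<in>{1..n}. P (Xs i))
         \<and> Z homeomorphic_space sum_topology Xs {1..n} \<longrightarrow> P Z)"

definition open_base_at :: "'u topology \<Rightarrow> 'u \<Rightarrow> 'u set set \<Rightarrow> bool" where
  "open_base_at X p \<B> \<longleftrightarrow>
     (\<forall>B\<in>\<B>. openin X B \<and> p \<in> B) \<and>
     (\<forall>U. openin X U \<and> p \<in> U \<longrightarrow> (\<exists>B\<in>\<B>. B \<subseteq> U))"

definition Mrowka_W :: "('u topology \<Rightarrow> bool) \<Rightarrow> bool" where
  "Mrowka_W P \<longleftrightarrow>
     (\<forall>X. Tychonoff_space X \<and>
          (\<exists>p\<in>topspace X. \<exists>\<B>. open_base_at X p \<B> \<and>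
              (\<forall>B\<in>\<B>. P (subtopology X (topspace X - B))))
        \<longrightarrow> P X)"

definition compactness_like :: "('u topology \<Rightarrow> bool) \<Rightarrow> bool" where
  "compactness_like P \<longleftrightarrow>
     topological_property P \<and> clopen_hereditary P \<and> finitely_additive P \<and>
     perfect_property P \<and> Mrowka_W P"

definition compactness_like_pair ::
  "('u topology \<Rightarrow> bool) \<Rightarrow> ('u topology \<Rightarrow> bool) \<Rightarrow> bool" where
  "compactness_like_pair P Q \<longleftrightarrow>
     compactness_like P \<and>
     topological_property Q \<and> clopen_hereditary Q \<and> perfect_inverse_invariant Q \<and> Mrowka_W Q"

subsection \<open>Extensions\<close>

definition extension_of :: "'u topology \<Rightarrow> 'u topology \<Rightarrow> bool" where
  "extension_of X Y \<longleftrightarrow>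
     topspace X \<subseteq> topspace Y \<and> subtopology Y (topspace X) = X \<and>
     Y closure_of topspace X = topspace Y"

text \<open>The identification of extensions: an extension in the sense of the theory is an
  equivalence class of \<open>ext_rel X\<close>, so that equality of extensions is equality of classes.\<close>

definition ext_rel :: "'u topology \<Rightarrow> ('u topology \<times> 'u topology) set" where
  "ext_rel X = {(Y, Y'). extension_of X Y \<and> extension_of X Y' \<and>
     (\<exists>h. homeomorphic_map Y Y' h \<and> (\<forall>x\<in>topspace X. h x = x))}"

text \<open>Single spaces (representatives of classes).\<close>

definition ext_spaces :: "'u topology \<Rightarrow> 'u topology set" where
  "ext_spaces X = {Y. extension_of X Y \<and> Tychonoff_space Y \<and>
     compactin Y (topspace Y - topspace X)}"

definition prop_ext_spaces :: "('u topology \<Rightarrow> bool) \<Rightarrow> 'u topology \<Rightarrow> 'u topology set" where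
  "prop_ext_spaces P X = {Y \<in> ext_spaces X. P Y}"

definition minimal_ext :: "('u topology \<Rightarrow> bool) \<Rightarrow> 'u topology \<Rightarrow> 'u topology \<Rightarrow> bool" where
  "minimal_ext P X Y \<longleftrightarrow> Y \<in> prop_ext_spaces P X \<and>
     \<not> (\<exists>Z\<in>prop_ext_spaces P X. topspace Z \<subset> topspace Y \<and> subtopology Y (topspace Z) = Z)"

definition optimal_ext :: "('u topology \<Rightarrow> bool) \<Rightarrow> 'u topology \<Rightarrow> 'u topology \<Rightarrow> bool" where
  "optimal_ext P X Y \<longleftrightarrow> minimal_ext P X Y \<and>
     \<not> (\<exists>Z\<in>prop_ext_spaces P X. topspace Z = topspace Y \<and> {U. openin Y U} \<subset> {U. openin Z U})"

text \<open>Sets of extensions (sets of classes). As a superscript and as a subscript the property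
  plays the same role, so \<open>prop_exts\<close> serves for both; the two-property versions are
  the intersections.\<close>

definition prop_exts :: "('u topology \<Rightarrow> bool) \<Rightarrow> 'u topology \<Rightarrow> 'u topology set set" where
  "prop_exts P X = prop_ext_spaces P X // ext_rel X"

definition prop_exts2 ::
  "('u topology \<Rightarrow> bool) \<Rightarrow> ('u topology \<Rightarrow> bool) \<Rightarrow> 'u topology \<Rightarrow> 'u topology set set" where
  "prop_exts2 P Q X = prop_exts Q X \<inter> prop_exts P X"

definition optimal_exts :: "('u topology \<Rightarrow> bool) \<Rightarrow> 'u topology \<Rightarrow> 'u topology set set" where
  "optimal_exts P X = {Y. optimal_ext P X Y} // ext_rel X"

definition optimal_exts2 ::
  "('u topology \<Rightarrow> bool) \<Rightarrow> ('u topology \<Rightarrow> bool) \<Rightarrow> 'u topology \<Rightarrow> 'u topology set set" where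
  "optimal_exts2 P Q X = prop_exts Q X \<inter> optimal_exts P X"

definition le_inj_space :: "'u topology \<Rightarrow> 'u topology \<Rightarrow> 'u topology \<Rightarrow> bool" where
  "le_inj_space X Y Y' \<longleftrightarrow>
     (\<exists>f. continuous_map Y' Y f \<and> inj_on f (topspace Y') \<and> (\<forall>x\<in>topspace X. f x = x))"

definition le_inj :: "'u topology \<Rightarrow> 'u topology set \<Rightarrow> 'u topology set \<Rightarrow> bool" where
  "le_inj X S T \<longleftrightarrow> (\<exists>Y\<in>S. \<exists>Y'\<in>T. le_inj_space X Y Y')"

subsection \<open>Order\<close>

definition cofinal_in :: "('a \<Rightarrow> 'a \<Rightarrow> bool) \<Rightarrow> 'a set \<Rightarrow> 'a set \<Rightarrow> bool" where
  "cofinal_in le L A \<longleftrightarrow> A \<subseteq> L \<and> (\<forall>x\<in>L. \<exists>a\<in>A. le x a)"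

definition maximal_in :: "('a \<Rightarrow> 'a \<Rightarrow> bool) \<Rightarrow> 'a set \<Rightarrow> 'a \<Rightarrow> bool" where
  "maximal_in le L x \<longleftrightarrow> x \<in> L \<and> (\<forall>y\<in>L. le x y \<longrightarrow> y = x)"

subsection \<open>The definitions on classes do not depend on representatives\<close>

lemma equiv_ext_rel: "equiv {Y. extension_of X Y} (ext_rel X)"
proof (rule equivI)
  show "ext_rel X \<subseteq> {Y. extension_of X Y} \<times> {Y. extension_of X Y}"
    by (auto simp: ext_rel_def)
  show "refl_on {Y. extension_of X Y} (ext_rel X)"
    unfolding ext_rel_def refl_on_def
    by (auto intro!: exI[of _ "\<lambda>x. x"] simp: homeomorphic_map_def quotient_map_def inj_on_def)
       (metis openin_subset Collect_conj_eq Collect_mem_eq inf.absorb_iff2)+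
  show "sym (ext_rel X)"
  proof (rule symI)
    fix Y Y' assume "(Y, Y') \<in> ext_rel X"
    then obtain h where e: "extension_of X Y" "extension_of X Y'"
      and h: "homeomorphic_map Y Y' h" "\<forall>x\<in>topspace X. h x = x"
      by (auto simp: ext_rel_def)
    obtain g where g: "homeomorphic_maps Y Y' h g"
      using h(1) by (auto simp: homeomorphic_map_maps)
    have "homeomorphic_map Y' Y g"
      using g homeomorphic_maps_map by blast
    moreover have "g x = x" if "x \<in> topspace X" for x
      using g h(2) that e unfolding homeomorphic_maps_def extension_of_def by (metis subsetD)
    ultimately show "(Y', Y) \<in> ext_rel X"
      using e by (auto simp: ext_rel_def)
  qed
  show "trans (ext_rel X)"
  proof (rule transI)
    fix Y Y' Y'' assume "(Y, Y') \<in> ext_rel X" "(Y', Y'') \<in> ext_rel X"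
    then obtain h k where e: "extension_of X Y" "extension_of X Y''"
      and h: "homeomorphic_map Y Y' h" "\<forall>x\<in>topspace X. h x = x"
      and k: "homeomorphic_map Y' Y'' k" "\<forall>x\<in>topspace X. k x = x"
      by (auto simp: ext_rel_def)
    have "homeomorphic_map Y Y'' (k \<circ> h)"
      using h k homeomorphic_map_compose by blast
    then show "(Y, Y'') \<in> ext_rel X"
      using e h k by (auto simp: ext_rel_def intro!: exI[of _ "k \<circ> h"])
  qed
qed

lemma le_inj_class_iff:
  assumes "extension_of X Y" "extension_of X Y'"
  shows "le_inj X (ext_rel X `` {Y}) (ext_rel X `` {Y'}) \<longleftrightarrow> le_inj_space X Y Y'"
proof
  assume "le_inj X (ext_rel X `` {Y}) (ext_rel X `` {Y'})"
  then obtain Z Z' f where Z: "(Y, Z) \<in> ext_rel X" "(Y', Z') \<in> ext_rel X"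
    and f: "continuous_map Z' Z f" "inj_on f (topspace Z')" "\<forall>x\<in>topspace X. f x = x"
    by (auto simp: le_inj_def le_inj_space_def)
  have "(Z, Y) \<in> ext_rel X"
    using Z(1) equiv_ext_rel[of X] by (meson equivE symE)
  then obtain h where h: "homeomorphic_map Z Y h" "\<forall>x\<in>topspace X. h x = x"
    by (auto simp: ext_rel_def)
  obtain k where k: "homeomorphic_map Y' Z' k" "\<forall>x\<in>topspace X. k x = x"
    using Z(2) by (auto simp: ext_rel_def)
  have "continuous_map Y' Y (h \<circ> (f \<circ> k))"
    using f h k by (meson continuous_map_compose homeomorphic_imp_continuous_map)
  moreover have "inj_on (h \<circ> (f \<circ> k)) (topspace Y')"
  proof (intro comp_inj_on)
    show "inj_on k (topspace Y')"
      using k(1) by (simp add: homeomorphic_map_def)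
    have k_im: "k ` topspace Y' = topspace Z'"
      using k(1) by (simp add: homeomorphic_imp_surjective_map)
    then show "inj_on f (k ` topspace Y')"
      using f by simp
    have "f ` topspace Z' \<subseteq> topspace Z"
      using f(1) by (simp add: continuous_map_image_subset_topspace)
    moreover have "inj_on h (topspace Z)"
      using h(1) by (simp add: homeomorphic_map_def)
    ultimately show "inj_on h ((f \<circ> k) ` topspace Y')"
      using k_im by (metis image_comp inj_on_subset)
  qed
  ultimately show "le_inj_space X Y Y'"
    using f h k by (auto simp: le_inj_space_def intro!: exI[of _ "h \<circ> (f \<circ> k)"])
next
  assume "le_inj_space X Y Y'"
  moreover have "Y \<in> ext_rel X `` {Y}" "Y' \<in> ext_rel X `` {Y'}"
    using assms equiv_class_self[OF equiv_ext_rel] by auto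
  ultimately show "le_inj X (ext_rel X `` {Y}) (ext_rel X `` {Y'})"
    by (auto simp: le_inj_def)
qed

end

theory Submission
  imports Defs
begin

text \<open>
  Let \<open>K\<close> be the remainder of \<open>Y \<in> \<E>(X)\<close>. Collapsing \<open>K\<close> to a point and applying (W), one
  sees that \<open>Y\<close> has \<open>\<P>\<close> iff \<open>X - U\<close> has \<open>\<P>\<close> for every open \<open>U \<supseteq> K\<close>. Hence every extension
  in \<open>\<E>(X)\<close> has \<open>\<Q>\<close> as soon as \<open>X\<close> does, and \<open>\<P>\<close> passes to coarser topologies on an extension
  and to larger remainders.
  So an injection over \<open>X\<close> from a \<open>\<P>\<close>-extension into an optimal one is onto (minimality of
  the target) and a homeomorphism (maximality of its topology). Conversely, order the
  \<open>\<P>\<close>-extensions by ``fewer points and finer topology''. A chain is bounded by the intersection of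
  its members with the topology generated by all traces; compactness of the remainders shows that
  the bound has \<open>\<P>\<close>. Maximal elements are optimal, so Zorn's lemma puts an optimal extension
  above every \<open>\<P>\<close>-extension.
\<close>

section \<open>Quotient topologies, copies of sums, closed subspaces\<close>

text \<open>Serves two purposes: collapsing a compact set to a point, and, for injective
  \<open>f\<close>, carrying a topology over to another set of points, since an injective quotient
  map is a homeomorphism onto its image.\<close>

lemma exists_quotient_topology:
  fixes T :: "'a topology" and f :: "'a \<Rightarrow> 'b"
  obtains Z where "quotient_map T Z f" "topspace Z = f ` topspace T"
proof -
  define O' where "O' = (\<lambda>U. U \<subseteq> f ` topspace T \<and> openin T {x \<in> topspace T. f x \<in> U})"
  have top: "istopology O'"
  proof -
    have "openin T {x \<in> topspace T. f x \<in> U \<inter> V}"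
      if "openin T {x \<in> topspace T. f x \<in> U}" "openin T {x \<in> topspace T. f x \<in> V}" for U V
    proof -
      have "{x \<in> topspace T. f x \<in> U \<inter> V} = {x \<in> topspace T. f x \<in> U} \<inter> {x \<in> topspace T. f x \<in> V}"
        by auto
      then show ?thesis using that by (simp add: openin_Int)
    qed
    moreover have "openin T {x \<in> topspace T. f x \<in> \<Union>\<U>}"
      if "\<forall>U\<in>\<U>. openin T {x \<in> topspace T. f x \<in> U}" for \<U>
    proof -
      have "{x \<in> topspace T. f x \<in> \<Union>\<U>} = (\<Union>U\<in>\<U>. {x \<in> topspace T. f x \<in> U})"
        by auto
      show ?thesis
        unfolding \<open>_ = (\<Union>U\<in>\<U>. _)\<close> using that by (intro openin_Union) auto
    qed
    ultimately show ?thesis unfolding istopology_def O'_def by blast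
  qed
  define Z where "Z = topology O'"
  have Z: "openin Z = O'"
    using top by (simp add: Z_def topology_inverse')
  have "O' (f ` topspace T)"
  proof -
    have "{x \<in> topspace T. f x \<in> f ` topspace T} = topspace T" by auto
    then show ?thesis by (simp add: O'_def)
  qed
  then have ts: "topspace Z = f ` topspace T"
    using openin_subset[of Z] openin_topspace[of Z] unfolding Z by (intro equalityI) (auto simp: O'_def)
  moreover have "quotient_map T Z f"
    unfolding quotient_map_def ts Z by (simp add: O'_def)
  ultimately show thesis using that by blast
qed

lemma topological_property_homeomorphic_map:
  assumes "topological_property P" "homeomorphic_map X Y f" "P X"
  shows "P Y"
  using assms unfolding topological_property_def by (metis homeomorphic_map_imp_homeomorphic_space)

text \<open>Cardinal arithmetic: twice an infinite cardinal is that cardinal. This gives room inside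
  \<open>'u\<close> for a copy of the topological sum of two spaces on \<open>'u\<close>.\<close>

lemma ex_inj_UNIV_times_bool:
  assumes "infinite (UNIV :: 'u set)"
  obtains e :: "bool \<times> 'u \<Rightarrow> 'u" where "inj e"
proof -
  obtain a :: 'u where True by blast
  have "infinite (UNIV - {a})" using assms by simp
  then obtain b where "b \<noteq> a" by (metis Diff_iff finite.emptyI insertI1 subset_empty subsetI)
  then have "inj (\<lambda>c. if c then a else b)" by (auto simp: inj_def)
  then have "(card_of (UNIV :: bool set), card_of (UNIV :: 'u set)) \<in> ordLeq"
    by (subst card_of_ordLeq[symmetric]) blast
  then have "(card_of ((UNIV :: bool set) \<times> (UNIV :: 'u set)), card_of (UNIV :: 'u set)) \<in> ordLeq"
    using card_of_Times_infinite[OF assms UNIV_not_empty] ordIso_imp_ordLeq by blast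
  then show thesis
    using that by (metis UNIV_Times_UNIV card_of_ordLeq)
qed

text \<open>The inclusion of a closed subspace together with the identity is a perfect surjection
  \<open>C \<oplus> X \<rightarrow> X\<close>, and \<open>C\<close> is clopen in \<open>C \<oplus> X\<close>. This sum has a copy inside \<open>'u\<close>
  only when \<open>'u\<close> is infinite; otherwise \<open>X\<close> is discrete.\<close>

lemma closed_hereditary:
  fixes P :: "'u topology \<Rightarrow> bool"
  assumes P: "topological_property P" "clopen_hereditary P" "perfect_inverse_invariant P"
    and X: "Hausdorff_space X" "P X" and C: "closedin X C"
  shows "P (subtopology X C)"
proof (cases "finite (UNIV :: 'u set)")
  case True
  then have "X = discrete_topology (topspace X)"
    using X(1) finite_topspace_imp_discrete_topology rev_finite_subset by blast
  then have "openin X C"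
    using closedin_subset[OF C] by (metis openin_discrete_topology)
  then show ?thesis
    using P(2) X(2) C by (simp add: clopen_hereditary_def)
next
  case False
  then obtain e :: "bool \<times> 'u \<Rightarrow> 'u" where e: "inj e"
    by (rule ex_inj_UNIV_times_bool)
  have CX: "C \<subseteq> topspace X" using C by (rule closedin_subset)
  define F where "F = (\<lambda>b. if b then subtopology X C else X)"
  define S where "S = sum_topology F UNIV"
  have tS: "topspace S = Sigma UNIV (\<lambda>b. if b then C else topspace X)"
    using CX by (simp add: S_def F_def o_def if_distrib inf.absorb2 cong: if_cong)
  \<comment> \<open>The points of \<open>S\<close> are pairs, so \<open>P\<close> cannot be applied
    to \<open>S\<close>. Since \<open>e\<close> is injective, \<open>Z\<close> is a homeomorphic
    copy of \<open>S\<close> carried by \<open>'u\<close>.\<close>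
  obtain Z where Z: "quotient_map S Z e"
    by (rule exists_quotient_topology)
  then have eh: "homeomorphic_map S Z e"
    using e inj_on_subset by (auto simp: homeomorphic_map_def)
  then obtain g where g: "homeomorphic_maps S Z e g"
    by (auto simp: homeomorphic_map_maps)
  then have gh: "homeomorphic_map Z S g"
    using homeomorphic_maps_map by blast
  have cont: "continuous_map S X snd"
    unfolding continuous_map_def
  proof (intro conjI allI impI)
    show "snd \<in> topspace S \<rightarrow> topspace X"
    proof
      fix p assume "p \<in> topspace S"
      then have "snd p \<in> (if fst p then C else topspace X)" by (auto simp: tS)
      then show "snd p \<in> topspace X" using CX by (cases "fst p") auto
    qed
    fix U assume U: "openin X U"
    have "{x. (b, x) \<in> {x \<in> topspace S. snd x \<in> U}} = U \<inter> topspace (F b)" for b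
      using CX by (auto simp: tS F_def)
    moreover have "openin (F b) (U \<inter> topspace (F b))" for b
      using U CX by (auto simp: F_def openin_subtopology_Int openin_Int inf.absorb2)
    ultimately show "openin S {x \<in> topspace S. snd x \<in> U}"
      by (auto simp: S_def openin_sum_topology)
  qed
  have closed: "closed_map S X snd"
    unfolding closed_map_def
  proof (intro allI impI)
    fix U assume "closedin S U"
    then have U: "closedin (F b) {x. (b, x) \<in> U}" for b
      by (simp add: S_def closedin_sum_topology)
    have "closedin X {x. (True, x) \<in> U}"
      using U[of True] C by (simp add: F_def closedin_closed_subtopology)
    moreover have "closedin X {x. (False, x) \<in> U}"
      using U[of False] by (simp add: F_def)
    moreover have "snd ` U = {x. (True, x) \<in> U} \<union> {x. (False, x) \<in> U}"
      by (auto simp: image_def) (metis (full_types), metis snd_conv, metis snd_conv)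
    ultimately show "closedin X (snd ` U)" by (metis closedin_Un)
  qed
  \<comment> \<open>A fibre of \<open>snd\<close> has at most two points, one for each
    summand.\<close>
  have fib: "compactin S {x \<in> topspace S. snd x = y}" for y
  proof (rule finite_imp_compactin)
    have "{x \<in> topspace S. snd x = y} \<subseteq> UNIV \<times> {y}" by auto
    then show "finite {x \<in> topspace S. snd x = y}"
      by (rule finite_subset) simp
  qed blast
  have proper: "proper_map S X snd"
    using closed fib by (simp add: proper_map_def)
  have haus: "Hausdorff_space S"
    unfolding Hausdorff_space_def
  proof (intro allI impI)
    fix p q assume pq: "p \<in> topspace S \<and> q \<in> topspace S \<and> p \<noteq> q"
    obtain b x c y where [simp]: "p = (b, x)" "q = (c, y)" by (meson surj_pair)
    have op: "openin S ({b} \<times> topspace (F b))" for b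
    proof -
      have "{b} \<times> topspace (F b) = (\<lambda>x. (b, x)) ` topspace (F b)" by auto
      then show ?thesis
        using open_map_component_injection[of b UNIV F] by (simp add: S_def open_map_def)
    qed
    have in_F: "x \<in> topspace (F b)" "y \<in> topspace (F c)"
      using pq by (auto simp: S_def)
    show "\<exists>U V. openin S U \<and> openin S V \<and> p \<in> U \<and> q \<in> V \<and> disjnt U V"
    \<comment> \<open>Points in different summands are separated by the summands themselves, points
      in the same one by preimages under \<open>snd\<close> of disjoint open sets of
      \<open>X\<close>.\<close>
    proof (cases "b = c")
      case False
      then show ?thesis
        using in_F op[of b] op[of c]
        by (intro exI[of _ "{b} \<times> topspace (F b)"] exI[of _ "{c} \<times> topspace (F c)"])
          (auto simp: disjnt_def)
    next
      case True
      then have "x \<noteq> y" "x \<in> topspace X" "y \<in> topspace X"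
        using pq in_F by (auto simp: F_def split: if_splits)
      then obtain U V where "openin X U" "openin X V" "x \<in> U" "y \<in> V" "disjnt U V"
        using X(1) unfolding Hausdorff_space_def by metis
      then show ?thesis
        using pq openin_continuous_map_preimage[OF cont]
        by (intro exI[of _ "{x \<in> topspace S. snd x \<in> U}"] exI[of _ "{x \<in> topspace S. snd x \<in> V}"])
          (simp add: disjnt_iff)
    qed
  qed
  have hausZ: "Hausdorff_space Z"
    using haus eh homeomorphic_Hausdorff_space homeomorphic_map_imp_homeomorphic_space by blast
  have "perfect_mapping Z X (snd \<circ> g)"
    unfolding perfect_mapping_def
    using hausZ continuous_map_compose[OF homeomorphic_imp_continuous_map[OF gh] cont]
      proper_map_compose[OF homeomorphic_imp_proper_map[OF gh] proper]
    by blast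
  moreover have "(snd \<circ> g) ` topspace Z = topspace X"
  proof -
    have "g ` topspace Z = topspace S"
      using gh by (simp add: homeomorphic_imp_surjective_map)
    moreover have "snd ` topspace S = topspace X"
    proof
      show "snd ` topspace S \<subseteq> topspace X"
        using cont by (rule continuous_map_image_subset_topspace)
      show "topspace X \<subseteq> snd ` topspace S"
        by (force simp: tS image_iff)
    qed
    ultimately show ?thesis by (metis image_comp)
  qed
  ultimately have "P Z"
    using P(3) X(2) unfolding perfect_inverse_invariant_def by blast
  define D where "D = {True} \<times> C"
  have "D \<subseteq> Sigma UNIV (topspace \<circ> F)"
    using CX by (auto simp: D_def F_def)
  moreover have "{x. (b, x) \<in> D} = (if b then C else {})" for b
    by (simp add: D_def)
  moreover have "openin (subtopology X C) C" "closedin (subtopology X C) C"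
    using CX by (metis openin_topspace topspace_subtopology_subset,
        metis closedin_topspace topspace_subtopology_subset)
  ultimately have "openin S D" "closedin S D"
    unfolding S_def openin_sum_topology closedin_sum_topology by (simp_all add: F_def)
  then have "openin Z (e ` D)" "closedin Z (e ` D)"
    using eh by (meson homeomorphic_imp_open_map homeomorphic_imp_closed_map open_map_def closed_map_def)+
  then have "P (subtopology Z (e ` D))"
    using P(2) \<open>P Z\<close> by (auto simp: clopen_hereditary_def)
  moreover have "subtopology X C homeomorphic_space subtopology Z (e ` D)"
  proof -
    have "subtopology X C homeomorphic_space subtopology S D"
    proof -
      have "(\<lambda>x. (True, x)) ` topspace (F True) = D"
        using CX by (auto simp: F_def D_def)
      then have "homeomorphic_map (F True) (subtopology S D) (\<lambda>x. (True, x))"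
        using embedding_map_component_injection[of True UNIV F]
        by (simp add: embedding_map_def S_def)
      then show ?thesis
        using homeomorphic_map_imp_homeomorphic_space by (fastforce simp: F_def)
    qed
    moreover have "subtopology S D homeomorphic_space subtopology Z (e ` D)"
    proof -
      have "D \<subseteq> topspace S" using CX by (auto simp: D_def tS)
      then have "e ` (topspace S \<inter> D) = topspace Z \<inter> e ` D"
        using homeomorphic_imp_surjective_map[OF eh] by auto
      then show ?thesis
        by (rule homeomorphic_map_imp_homeomorphic_space[OF homeomorphic_map_subtopologies[OF eh]])
    qed
    ultimately show ?thesis by (rule homeomorphic_space_trans)
  qed
  ultimately show ?thesis
    using P(1) homeomorphic_space_sym unfolding topological_property_def by metis
qed

section \<open>Collapsing the remainder to a point\<close>

text \<open>The point \<open>p\<close> of \<open>K\<close> represents the collapsed set, so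
  \<open>Z\<close> lives on the points outside \<open>K\<close> together with \<open>p\<close>.
  Complements of neighbourhoods of \<open>p\<close> are then literally subspaces of
  \<open>Y\<close>, the form in which condition (W) at \<open>p\<close> can be checked.\<close>

lemma collapse_compact:
  fixes Y :: "'u topology"
  assumes Y: "Tychonoff_space Y" and K: "compactin Y K" and p: "p \<in> K"
  obtains Z q where "perfect_mapping Y Z q" "q ` topspace Y = topspace Z" "Tychonoff_space Z"
    "p \<in> topspace Z"
    "\<And>U. openin Z U \<Longrightarrow> p \<in> U \<Longrightarrow>
       \<exists>V. openin Y V \<and> K \<subseteq> V \<and> topspace Z - U = topspace Y - V \<and>
         subtopology Z (topspace Z - U) = subtopology Y (topspace Y - V)"
proof -
  have cr: "completely_regular_space Y" and H: "Hausdorff_space Y"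
    using Y by (auto simp: Tychonoff_space_def)
  have KY: "K \<subseteq> topspace Y" using K by (rule compactin_subset_topspace)
  have Kc: "closedin Y K" using H K by (rule compactin_imp_closedin)
  define q where "q = (\<lambda>x. if x \<in> K then p else x)"
  obtain Z where Z: "quotient_map Y Z q" and tZ: "topspace Z = q ` topspace Y"
    by (rule exists_quotient_topology)
  have tZ': "topspace Z = insert p (topspace Y - K)"
    using p KY by (auto simp: tZ q_def)
  have opZ: "openin Z U \<longleftrightarrow> openin Y {x \<in> topspace Y. q x \<in> U}" if "U \<subseteq> topspace Z" for U
    using Z that by (simp add: quotient_map_def)
  have clZ: "closedin Z U \<longleftrightarrow> closedin Y {x \<in> topspace Y. q x \<in> U}" if "U \<subseteq> topspace Z" for U
    using Z that unfolding quotient_map_closedin by blast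
  have cont: "continuous_map Y Z q"
    using Z by (rule quotient_imp_continuous_map)
  have closed: "closed_map Y Z q"
    unfolding closed_map_def
  proof (intro allI impI)
    fix C assume C: "closedin Y C"
    have CY: "C \<subseteq> topspace Y" using C by (rule closedin_subset)
    \<comment> \<open>The saturation of a closed set is either the set itself or its union with
      \<open>K\<close>; both are closed because \<open>K\<close> is compact in a Hausdorff
      space.\<close>
    have "{x \<in> topspace Y. q x \<in> q ` C} = (if C \<inter> K = {} then C else C \<union> K)"
      using CY KY p by (auto simp: q_def split: if_splits)
    then have "closedin Y {x \<in> topspace Y. q x \<in> q ` C}"
      using C Kc by auto
    then show "closedin Z (q ` C)"
      using CY by (subst clZ) (auto simp: tZ)
  qed
  have fib: "compactin Y {x \<in> topspace Y. q x = y}" for y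
  proof (cases "y = p")
    case True
    then have "{x \<in> topspace Y. q x = y} = K"
      using KY p by (auto simp: q_def)
    then show ?thesis using K by simp
  next
    case False
    then have "{x \<in> topspace Y. q x = y} \<subseteq> {y}"
      by (auto simp: q_def split: if_splits)
    then show ?thesis by (intro finite_imp_compactin) (auto intro: finite_subset)
  qed
  have perf: "perfect_mapping Y Z q"
    using H cont closed fib by (simp add: perfect_mapping_def proper_map_def)
  have "completely_regular_space Z"
    unfolding completely_regular_space_alt
  proof (intro allI impI)
    fix S x assume S: "closedin Z S" and x: "x \<in> topspace Z - S"
    have preS: "closedin Y {y \<in> topspace Y. q y \<in> S}"
      using S cont by (simp add: closedin_continuous_map_preimage)
    \<comment> \<open>A function constant on \<open>K\<close> satisfies
      \<open>g \<circ> q = g\<close> and so descends to the quotient. It remains to find in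
      \<open>Y\<close> a separating function that is constant on \<open>K\<close>.\<close>
    have lift: "\<exists>f. continuous_map Z euclideanreal f \<and> f x = 0 \<and> f ` S \<subseteq> {1}"
      if g: "continuous_map Y euclideanreal g" "g ` {y \<in> topspace Y. q y \<in> S} \<subseteq> {1}"
        and "g x = 0" "\<And>k. k \<in> K \<Longrightarrow> g k = g p" for g
    proof (intro exI conjI)
      have "(g \<circ> q) y = g y" for y
        using that by (simp add: q_def)
      then have "g \<circ> q = g" by auto
      then show "continuous_map Z euclideanreal g"
        using continuous_compose_quotient_map[OF Z] g by metis
      show "g ` S \<subseteq> {1}"
      proof (clarify)
        fix s assume s: "s \<in> S"
        then have "s \<in> topspace Z" using S closedin_subset by auto
        then have "s \<in> topspace Y" "q s = s" using p KY tZ' by (auto simp: q_def)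
        then have "s \<in> {y \<in> topspace Y. q y \<in> S}" using s by simp
        then show "g s = 1" using g(2) by blast
      qed
    qed fact
    show "\<exists>f. continuous_map Z euclideanreal f \<and> f x = 0 \<and> f ` S \<subseteq> {1}"
    proof (cases "x = p")
      case True
      then have "disjnt K {y \<in> topspace Y. q y \<in> S}"
        using x by (auto simp: disjnt_def q_def)
      then obtain g where "continuous_map Y euclideanreal g"
          "g ` {y \<in> topspace Y. q y \<in> S} \<subseteq> {1}" "g ` K \<subseteq> {0}"
        using Urysohn_completely_regular_compact_closed_alt[OF cr K preS] by metis
      then show ?thesis
        using True p by (intro lift[of g]) (simp_all add: image_subset_iff)
    next
      case False
      \<comment> \<open>Adding \<open>K\<close> to the closed set to be separated from
        \<open>x\<close> forces the function to be constantly 1 on \<open>K\<close>. In the other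
        case, \<open>x = p\<close>, it was made 0 on the compact set \<open>K\<close>.\<close>
      define C where "C = {y \<in> topspace Y. q y \<in> S} \<union> K"
      have "closedin Y C" using preS Kc by (auto simp: C_def)
      moreover have "x \<in> topspace Y - C"
        using x False tZ' by (auto simp: C_def q_def split: if_splits)
      ultimately obtain g where "continuous_map Y euclideanreal g" "g x = 0" "g ` C \<subseteq> {1}"
        using cr unfolding completely_regular_space_alt by blast
      then show ?thesis
        using p by (intro lift[of g]) (simp_all add: C_def image_subset_iff)
    qed
  qed
  moreover have "t1_space Z"
    using closed tZ H Hausdorff_imp_t1_space t1_space_closed_map_image by metis
  ultimately have TZ: "Tychonoff_space Z"
    unfolding Tychonoff_space_def
    using completely_regular_imp_regular_space regular_t1_imp_Hausdorff_space by blast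
  have compl: "\<exists>V. openin Y V \<and> K \<subseteq> V \<and> topspace Z - U = topspace Y - V \<and>
         subtopology Z (topspace Z - U) = subtopology Y (topspace Y - V)"
    if U: "openin Z U" "p \<in> U" for U
  proof (intro exI conjI)
    let ?V = "{x \<in> topspace Y. q x \<in> U}"
    show V: "openin Y ?V" using cont U by (simp add: openin_continuous_map_preimage)
    show KV: "K \<subseteq> ?V" using KY U by (auto simp: q_def)
    show eq: "topspace Z - U = topspace Y - ?V"
      using U KY by (auto simp: tZ' q_def split: if_splits)
    have "openin (subtopology Z (topspace Z - U)) W \<longleftrightarrow> openin (subtopology Y (topspace Y - ?V)) W" for W
    proof
      assume "openin (subtopology Z (topspace Z - U)) W"
      then obtain T where T: "openin Z T" "W = T \<inter> (topspace Z - U)"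
        by (auto simp: openin_subtopology)
      then have "W = {x \<in> topspace Y. q x \<in> T} \<inter> (topspace Y - ?V)"
        unfolding eq using KV by (auto simp: q_def)
      then show "openin (subtopology Y (topspace Y - ?V)) W"
        using T cont openin_continuous_map_preimage unfolding openin_subtopology by blast
    next
      assume "openin (subtopology Y (topspace Y - ?V)) W"
      then obtain T where T: "openin Y T" "W = T \<inter> (topspace Y - ?V)"
        by (auto simp: openin_subtopology)
      have TY: "T \<subseteq> topspace Y" using T openin_subset by auto
      \<comment> \<open>Removing \<open>K\<close> makes \<open>T\<close> saturated and keeps it
        open, while its trace outside \<open>?V\<close> is unchanged because \<open>K\<close> lies
        in \<open>?V\<close>.\<close>
      have "{x \<in> topspace Y. q x \<in> T - K} = T - K"
        using TY p by (auto simp: q_def)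
      then have "openin Z (T - K)"
        using T Kc TY by (subst opZ) (auto simp: tZ')
      moreover have "W = (T - K) \<inter> (topspace Z - U)"
        unfolding T eq using KV by auto
      ultimately show "openin (subtopology Z (topspace Z - U)) W"
        unfolding openin_subtopology by blast
    qed
    then show "subtopology Z (topspace Z - U) = subtopology Y (topspace Y - ?V)"
      by (simp add: topology_eq)
  qed
  show thesis
    by (rule that[OF perf tZ[symmetric] TZ]) (simp add: tZ', rule compl)
qed

text \<open>The right-hand side sees \<open>Y\<close> only through the neighbourhoods of its
  remainder, so \<open>P\<close> can be compared across extensions of the same \<open>X\<close>.
  Forward, the complement of \<open>U\<close> is a closed subspace of \<open>Y\<close>; backward,
  (W) at the collapsed remainder gives \<open>P\<close> for the quotient, and inverse invariance
  pulls it back to \<open>Y\<close>.\<close>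

lemma ext_has_property_iff:
  fixes P :: "'u topology \<Rightarrow> bool"
  assumes P: "topological_property P" "clopen_hereditary P" "perfect_inverse_invariant P"
    "Mrowka_W P"
    and Y: "Y \<in> ext_spaces X"
  shows "P Y \<longleftrightarrow> (\<forall>U. openin Y U \<and> topspace Y - topspace X \<subseteq> U \<longrightarrow>
           P (subtopology X (topspace X - U)))" (is "_ \<longleftrightarrow> ?R")
proof -
  let ?K = "topspace Y - topspace X"
  have Ty: "Tychonoff_space Y" and K: "compactin Y ?K" and XY: "topspace X \<subseteq> topspace Y"
    and subX: "subtopology Y (topspace X) = X"
    using Y by (auto simp: ext_spaces_def extension_of_def)
  have sub: "subtopology X (topspace X - U) = subtopology Y (topspace Y - U)" if "?K \<subseteq> U" for U
  proof -
    have "topspace X - U = topspace Y - U" using that XY by auto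
    moreover have "subtopology X (topspace X - U) = subtopology Y (topspace X \<inter> (topspace X - U))"
      by (subst subX[symmetric]) (simp add: subtopology_subtopology)
    moreover have "topspace X \<inter> (topspace X - U) = topspace X - U" by auto
    ultimately show ?thesis by simp
  qed
  show ?thesis
  proof
    assume "P Y"
    have H: "Hausdorff_space Y" using Ty by (simp add: Tychonoff_space_def)
    show ?R
      using closed_hereditary[OF P(1-3) H \<open>P Y\<close>] sub by auto
  next
    assume R: ?R
    show "P Y"
    proof (cases "?K = {}")
      case True
      \<comment> \<open>With an empty remainder there is no point to collapse, but then
        \<open>Y = X\<close> and the neighbourhood \<open>{}\<close> of the remainder yields the
        claim.\<close>
      then have "P (subtopology X (topspace X - {}))" using R openin_empty by blast
      moreover have "Y = X" using True XY subX by (metis Diff_eq_empty_iff subset_antisym subtopology_topspace)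
      ultimately show ?thesis by simp
    next
      case False
      then obtain p where "p \<in> ?K" by blast
      then obtain Z q where Z: "perfect_mapping Y Z q" "q ` topspace Y = topspace Z"
          "Tychonoff_space Z" "p \<in> topspace Z"
        and op: "\<And>U. openin Z U \<Longrightarrow> p \<in> U \<Longrightarrow>
          \<exists>V. openin Y V \<and> ?K \<subseteq> V \<and> topspace Z - U = topspace Y - V \<and>
            subtopology Z (topspace Z - U) = subtopology Y (topspace Y - V)"
        using collapse_compact[OF Ty K] by blast
      have "P (subtopology Z (topspace Z - B))" if "openin Z B" "p \<in> B" for B
        using op[OF that] R sub by metis
      moreover have "open_base_at Z p {B. openin Z B \<and> p \<in> B}"
        by (auto simp: open_base_at_def)
      ultimately have "P Z"
        using P(4) Z(3,4) unfolding Mrowka_W_def by blast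
      then show ?thesis
        using P(3) Z(1,2) unfolding perfect_inverse_invariant_def by blast
    qed
  qed
qed

section \<open>Directed covers, transport and subspaces of extensions\<close>

text \<open>Directedness absorbs a finite subcover into one member, by induction on the subcover;
  \<open>\<U> \<noteq> {}\<close> takes care of the empty subcover.\<close>

lemma compactin_directed_cover:
  assumes K: "compactin T K" and op: "\<And>U. U \<in> \<U> \<Longrightarrow> openin T U" and cov: "K \<subseteq> \<Union>\<U>"
    and ne: "\<U> \<noteq> {}" and dir: "\<And>U V. U \<in> \<U> \<Longrightarrow> V \<in> \<U> \<Longrightarrow> \<exists>W\<in>\<U>. U \<union> V \<subseteq> W"
  shows "\<exists>U\<in>\<U>. K \<subseteq> U"
proof -
  obtain \<F> where \<F>: "finite \<F>" "\<F> \<subseteq> \<U>" "K \<subseteq> \<Union>\<F>"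
    using K op cov unfolding compactin_def by meson
  from \<F>(1,2) have "\<exists>U\<in>\<U>. \<Union>\<F> \<subseteq> U"
  proof (induction \<F> rule: finite_induct)
    case empty
    then show ?case using ne by auto
  next
    case (insert V \<F>)
    then obtain U where "U \<in> \<U>" "\<Union>\<F> \<subseteq> U" by auto
    then show ?case using dir[of V U] insert.prems by (metis Union_insert Un_mono insert_subset order.refl order.trans)
  qed
  then show ?thesis using \<F>(3) by (meson order.trans)
qed

lemma ext_spaces_homeomorphic:
  assumes T: "T \<in> ext_spaces X" and f: "homeomorphic_map T W f"
    and fX: "\<And>x. x \<in> topspace X \<Longrightarrow> f x = x"
  shows "W \<in> ext_spaces X"
proof -
  have T': "topspace X \<subseteq> topspace T" "subtopology T (topspace X) = X"
    "T closure_of topspace X = topspace T" "Tychonoff_space T"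
    "compactin T (topspace T - topspace X)"
    using T by (auto simp: ext_spaces_def extension_of_def)
  have im: "f ` topspace T = topspace W" using f by (rule homeomorphic_imp_surjective_map)
  have imX: "f ` topspace X = topspace X" using fX by auto
  have inj: "inj_on f (topspace T)" using f by (simp add: homeomorphic_map_def)
  have XW: "topspace X \<subseteq> topspace W" using T'(1) im imX by blast
  have "homeomorphic_map (subtopology T (topspace X)) (subtopology W (topspace X)) f"
    using f imX T'(1) XW by (intro homeomorphic_map_subtopologies) (auto simp: inf.absorb2)
  then have q: "quotient_map X (subtopology W (topspace X)) f"
    by (simp add: T'(2) homeomorphic_map_def)
  \<comment> \<open>Since \<open>f\<close> fixes the points of \<open>X\<close>, a subset of
    \<open>topspace X\<close> is its own preimage, so the two topologies on \<open>X\<close> are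
    equal and not merely homeomorphic.\<close>
  have sub: "subtopology W (topspace X) = X"
    unfolding topology_eq
  proof (intro allI)
    fix U
    show "openin (subtopology W (topspace X)) U = openin X U"
    proof (cases "U \<subseteq> topspace X")
      case True
      then have "{x \<in> topspace X. f x \<in> U} = U" using fX by auto
      moreover have "U \<subseteq> topspace (subtopology W (topspace X))" using True XW by simp
      ultimately show ?thesis using q unfolding quotient_map_def by metis
    next
      case False
      then show ?thesis
        using openin_imp_subset[of W "topspace X" U] openin_subset[of X U] by blast
    qed
  qed
  have "W closure_of topspace X = topspace W"
    using homeomorphic_map_closure_of[OF f T'(1)] by (simp add: imX T'(3) im)
  moreover have "Tychonoff_space W"
    using T'(4) homeomorphic_map_imp_homeomorphic_space[OF f]
    unfolding Tychonoff_space_def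
    by (metis homeomorphic_Hausdorff_space homeomorphic_completely_regular_space)
  moreover have "compactin W (topspace W - topspace X)"
  proof -
    have "f ` (topspace T - topspace X) = topspace W - topspace X"
      using inj_on_image_set_diff[OF inj] T'(1) by (metis Diff_subset im imX order.refl)
    then show ?thesis
      using image_compactin[OF T'(5) homeomorphic_imp_continuous_map[OF f]] by simp
  qed
  ultimately show ?thesis
    using XW sub by (simp add: ext_spaces_def extension_of_def)
qed

lemma ext_spaces_subspace:
  assumes S: "S \<in> ext_spaces X" and A: "topspace X \<subseteq> A" "A \<subseteq> topspace S"
    and K: "compactin S (A - topspace X)"
  shows "subtopology S A \<in> ext_spaces X"
proof -
  have S': "subtopology S (topspace X) = X" "S closure_of topspace X = topspace S" "Tychonoff_space S"
    using S by (auto simp: ext_spaces_def extension_of_def)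
  have "subtopology S A closure_of topspace X = A"
    using A S'(2) by (simp add: closure_of_subtopology inf.absorb1 inf.absorb2)
  moreover have "subtopology (subtopology S A) (topspace X) = X"
    using A S'(1) by (simp add: subtopology_subtopology inf.absorb2)
  moreover have "Tychonoff_space (subtopology S A)"
    using S'(3) by (simp add: Tychonoff_space_def completely_regular_space_subtopology Hausdorff_space_subtopology)
  ultimately show ?thesis
    using A K by (auto simp: ext_spaces_def extension_of_def compactin_subtopology inf.absorb2)
qed

text \<open>A point of \<open>B\<close> is already the value of \<open>f\<close> at itself, so
  injectivity leaves it for no other argument. With \<open>B\<close> the points of \<open>X\<close>,
  an injection over \<open>X\<close> sends remainder to remainder.\<close>

lemma inj_on_fixing_not_mem:
  assumes "inj_on f A" "B \<subseteq> A" "\<And>x. x \<in> B \<Longrightarrow> f x = x" "t \<in> A - B"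
  shows "f t \<notin> B"
proof
  assume "f t \<in> B"
  then have "f (f t) = f t" "f t \<in> A" using assms(2,3) by auto
  then show False using assms(1,4) \<open>f t \<in> B\<close> by (metis DiffD1 DiffD2 inj_onD)
qed

section \<open>Injections over \<open>X\<close> between extensions with \<open>P\<close>\<close>

context
  fixes P :: "'u topology \<Rightarrow> bool"
  assumes P: "topological_property P" "clopen_hereditary P" "perfect_inverse_invariant P"
    "Mrowka_W P"
begin

text \<open>The preimage of a neighbourhood of the remainder of \<open>S\<close> is a neighbourhood
  of the remainder of \<open>T\<close>, and both leave the same part of \<open>X\<close> uncovered,
  as \<open>f\<close> fixes \<open>X\<close>. The map may miss points of \<open>S\<close>, so both a
  coarser topology and a larger remainder are covered.\<close>

lemma ext_property_coarser:
  assumes T: "T \<in> ext_spaces X" and S: "S \<in> ext_spaces X"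
    and f: "continuous_map T S f" "inj_on f (topspace T)" "\<And>x. x \<in> topspace X \<Longrightarrow> f x = x"
    and PT: "P T"
  shows "P S"
proof -
  have XT: "topspace X \<subseteq> topspace T" using T by (auto simp: ext_spaces_def extension_of_def)
  have "P (subtopology X (topspace X - U))"
    if U: "openin S U" "topspace S - topspace X \<subseteq> U" for U
  proof -
    let ?V = "{t \<in> topspace T. f t \<in> U}"
    have "topspace T - topspace X \<subseteq> ?V"
    proof
      fix t assume t: "t \<in> topspace T - topspace X"
      then have "f t \<notin> topspace X" using inj_on_fixing_not_mem[OF f(2) XT f(3)] by blast
      moreover have "f t \<in> topspace S" using f(1) t by (auto simp: continuous_map_def)
      ultimately show "t \<in> ?V" using t U by auto
    qed
    moreover have "openin T ?V" using f(1) U by (simp add: openin_continuous_map_preimage)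
    ultimately have "P (subtopology X (topspace X - ?V))"
      using ext_has_property_iff[OF P T] PT by blast
    moreover have "topspace X - ?V = topspace X - U" using f(3) XT by auto
    ultimately show ?thesis by simp
  qed
  then show ?thesis using ext_has_property_iff[OF P S] by blast
qed

text \<open>The image \<open>?A\<close>, as a subspace of \<open>S\<close>, is again an extension
  with \<open>P\<close>, so minimality makes it all of \<open>S\<close>. Carrying the topology of
  \<open>T\<close> over to these points gives \<open>W\<close>, which refines \<open>S\<close>;
  maximality of the topology then gives \<open>S = W\<close>.\<close>

lemma optimal_ext_le_inj_imp_homeomorphic:
  assumes S: "optimal_ext P X S" and T: "T \<in> prop_ext_spaces P X"
    and f: "continuous_map T S f" "inj_on f (topspace T)" "\<And>x. x \<in> topspace X \<Longrightarrow> f x = x"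
  shows "homeomorphic_map T S f"
proof -
  have Se: "S \<in> ext_spaces X" "P S" and Te: "T \<in> ext_spaces X" "P T"
    using S T by (auto simp: optimal_ext_def minimal_ext_def prop_ext_spaces_def)
  have XT: "topspace X \<subseteq> topspace T" and KT: "compactin T (topspace T - topspace X)"
    using Te by (auto simp: ext_spaces_def extension_of_def)
  have imX: "f ` topspace X = topspace X" using f(3) by auto
  let ?A = "f ` topspace T"
  have A: "topspace X \<subseteq> ?A" "?A \<subseteq> topspace S"
    using XT imX f(1) by (blast, auto simp: continuous_map_def)
  have "f ` (topspace T - topspace X) = ?A - topspace X"
    using inj_on_image_set_diff[OF f(2)] XT by (metis Diff_subset imX order.refl)
  then have "compactin S (?A - topspace X)"
    using image_compactin[OF KT f(1)] by simp
  then have sub: "subtopology S ?A \<in> ext_spaces X"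
    using ext_spaces_subspace Se A by blast
  have "continuous_map T (subtopology S ?A) f"
    using f(1) by (simp add: continuous_map_in_subtopology)
  then have "P (subtopology S ?A)"
    using ext_property_coarser[OF Te(1) sub _ f(2,3) Te(2)] by blast
  then have "subtopology S ?A \<in> prop_ext_spaces P X" using sub by (simp add: prop_ext_spaces_def)
  moreover have tA: "topspace (subtopology S ?A) = ?A" using A by auto
  ultimately have surj: "?A = topspace S"
    using S A unfolding optimal_ext_def minimal_ext_def by (metis psubsetI)
  obtain W where "quotient_map T W f" and tW: "topspace W = ?A"
    by (rule exists_quotient_topology)
  then have W: "homeomorphic_map T W f" using f(2) by (simp add: homeomorphic_map_def)
  have "W \<in> ext_spaces X" using ext_spaces_homeomorphic[OF Te(1) W] f(3) by blast
  moreover have "P W" using topological_property_homeomorphic_map[OF P(1) W] Te by blast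
  ultimately have "W \<in> prop_ext_spaces P X" by (simp add: prop_ext_spaces_def)
  then have "\<not> {U. openin S U} \<subset> {U. openin W U}"
    using S tW surj unfolding optimal_ext_def by metis
  moreover have "openin W U" if "openin S U" for U
  proof -
    have "openin T {x \<in> topspace T. f x \<in> U}"
      using f(1) that by (simp add: openin_continuous_map_preimage)
    then show ?thesis
      using \<open>quotient_map T W f\<close> that openin_subset[OF that] tW surj by (simp add: quotient_map_def)
  qed
  ultimately have "openin S U \<longleftrightarrow> openin W U" for U by blast
  then have "S = W" by (simp add: topology_eq)
  then show ?thesis using W by simp
qed

section \<open>Bounds for chains of extensions\<close>

text \<open>Continuity of \<open>id\<close> from \<open>Y\<close> to \<open>Z\<close> says that the
  points of \<open>Y\<close> are among those of \<open>Z\<close> and that \<open>Y\<close> refines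
  the trace of \<open>Z\<close>. The work lies in the remainder of the bound: it is an intersection
  of compact sets, so each of its neighbourhoods is controlled by a single member of the
  chain.\<close>

lemma prop_ext_spaces_chain_bound:
  assumes C: "C \<subseteq> prop_ext_spaces P X" "C \<noteq> {}"
    and chain: "\<And>Y Z. Y \<in> C \<Longrightarrow> Z \<in> C \<Longrightarrow> continuous_map Y Z id \<or> continuous_map Z Y id"
  obtains W where "W \<in> prop_ext_spaces P X" "\<And>Z. Z \<in> C \<Longrightarrow> continuous_map W Z id"
proof -
  have ext: "Z \<in> ext_spaces X" "P Z" if "Z \<in> C" for Z
    using C that by (auto simp: prop_ext_spaces_def)
  have Z_props: "topspace X \<subseteq> topspace Z" "subtopology Z (topspace X) = X"
    "Z closure_of topspace X = topspace Z" "completely_regular_space Z" "Hausdorff_space Z"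
    "compactin Z (topspace Z - topspace X)" if "Z \<in> C" for Z
    using ext[OF that] by (auto simp: ext_spaces_def extension_of_def Tychonoff_space_def)
  obtain Z0 where Z0: "Z0 \<in> C" using C by auto
  have HX: "Hausdorff_space X" using Z_props(2,5)[OF Z0] Hausdorff_space_subtopology by metis
  have op_trace: "openin Z' (V \<inter> topspace Z')" if "continuous_map Z' Z id" "openin Z V"
    for Z Z' :: "'u topology" and V
  proof -
    have "{x \<in> topspace Z'. id x \<in> V} = V \<inter> topspace Z'" by auto
    then show ?thesis using openin_continuous_map_preimage[OF that] by simp
  qed
  \<comment> \<open>The chain enters through this directedness: finitely many open sets from
    different members can be compared in one common refinement.\<close>
  have dir: "\<exists>Z\<in>C. continuous_map Z Z1 id \<and> continuous_map Z Z2 id" if "Z1 \<in> C" "Z2 \<in> C" for Z1 Z2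
    using chain that by (metis continuous_map_id)
  define M where "M = (\<Inter>Z\<in>C. topspace Z)"
  have MZ: "M \<subseteq> topspace Z" if "Z \<in> C" for Z using that by (auto simp: M_def)
  have XM: "topspace X \<subseteq> M" using Z_props(1) by (auto simp: M_def)
  \<comment> \<open>The traces on \<open>M\<close> of open sets of members form a base. An
    intersection of two traces is again a trace, taken in a common refinement of the two
    members.\<close>
  define O' where "O' = (\<lambda>U. \<forall>x\<in>U. \<exists>Z\<in>C. \<exists>V. openin Z V \<and> x \<in> V \<inter> M \<and> V \<inter> M \<subseteq> U)"
  have "istopology O'"
    unfolding istopology_def
  proof (intro conjI allI impI)
    fix S T assume S: "O' S" and T: "O' T"
    show "O' (S \<inter> T)"
      unfolding O'_def
    proof
      fix x assume "x \<in> S \<inter> T"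
      then obtain Z1 V1 Z2 V2 where
        V: "Z1 \<in> C" "openin Z1 V1" "x \<in> V1 \<inter> M" "V1 \<inter> M \<subseteq> S"
           "Z2 \<in> C" "openin Z2 V2" "x \<in> V2 \<inter> M" "V2 \<inter> M \<subseteq> T"
        using S T unfolding O'_def by (metis IntD1 IntD2)
      then obtain Z where Z: "Z \<in> C" "continuous_map Z Z1 id" "continuous_map Z Z2 id"
        using dir by blast
      then have "openin Z ((V1 \<inter> topspace Z) \<inter> (V2 \<inter> topspace Z))"
        using op_trace V by blast
      then show "\<exists>Z\<in>C. \<exists>V. openin Z V \<and> x \<in> V \<inter> M \<and> V \<inter> M \<subseteq> S \<inter> T"
        using Z V MZ[OF Z(1)] by (intro bexI[of _ Z] exI[of _ "(V1 \<inter> topspace Z) \<inter> (V2 \<inter> topspace Z)"]) auto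
    qed
  next
    fix \<K> assume "\<forall>K\<in>\<K>. O' K"
    then show "O' (\<Union>\<K>)" unfolding O'_def by (meson Union_iff Union_upper order.trans)
  qed
  define W where "W = topology O'"
  have W: "openin W = O'" using \<open>istopology O'\<close> by (simp add: W_def topology_inverse')
  have op_basic: "openin W (V \<inter> M)" if "Z \<in> C" "openin Z V" for Z V
    using that unfolding W O'_def by blast
  have basic: "\<exists>Z\<in>C. \<exists>V. openin Z V \<and> x \<in> V \<inter> M \<and> V \<inter> M \<subseteq> U" if "openin W U" "x \<in> U" for U x
    using that unfolding W O'_def by blast
  have tW: "topspace W = M"
  proof
    show "topspace W \<subseteq> M" using basic[OF openin_topspace] by blast
    have "openin W (topspace Z0 \<inter> M)" using op_basic Z0 by blast
    then show "M \<subseteq> topspace W" using MZ[OF Z0] openin_subset by (metis inf.absorb2)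
  qed
  have cW: "continuous_map W Z id" if "Z \<in> C" for Z
    unfolding continuous_map_def
  proof (intro conjI allI impI)
    show "id \<in> topspace W \<rightarrow> topspace Z" using MZ[OF that] by (auto simp: tW)
    fix V assume "openin Z V"
    moreover have "{x \<in> topspace W. id x \<in> V} = V \<inter> M" by (auto simp: tW)
    ultimately show "openin W {x \<in> topspace W. id x \<in> V}" using op_basic that by simp
  qed
  have HW: "Hausdorff_space W"
    using Hausdorff_space_injective_preimage[OF Z_props(5)[OF Z0] cW[OF Z0]] by simp
  \<comment> \<open>A basic neighbourhood comes from one member \<open>Z\<close>, and a separating
    function on \<open>Z\<close> stays continuous for the finer topology on
    \<open>M\<close>.\<close>
  have CW: "completely_regular_space W"
    unfolding completely_regular_space_alt'
  proof (intro allI impI)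
    fix S x assume "openin W S" "x \<in> S"
    then obtain Z V where V: "Z \<in> C" "openin Z V" "x \<in> V \<inter> M" "V \<inter> M \<subseteq> S"
      using basic by blast
    then obtain f where f: "continuous_map Z euclideanreal f" "f x = 0" "f ` (topspace Z - V) \<subseteq> {1}"
      using Z_props(4)[OF V(1)] unfolding completely_regular_space_alt' by blast
    have "continuous_map W euclideanreal (f \<circ> id)"
      using f(1) cW[OF V(1)] by (rule continuous_map_compose[rotated])
    moreover have "topspace W - S \<subseteq> topspace Z - V" using V MZ[OF V(1)] by (auto simp: tW)
    ultimately show "\<exists>f. continuous_map W euclideanreal f \<and> f x = 0 \<and> f ` (topspace W - S) \<subseteq> {1}"
      using f by (intro exI[of _ f]) auto
  qed
  have subW: "subtopology W (topspace X) = X"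
    unfolding topology_eq
  proof (intro allI iffI)
    fix U assume "openin (subtopology W (topspace X)) U"
    then obtain T where T: "openin W T" "U = T \<inter> topspace X" by (auto simp: openin_subtopology)
    show "openin X U"
    proof (subst openin_subopen, intro ballI)
      fix x assume x: "x \<in> U"
      then obtain Z V where V: "Z \<in> C" "openin Z V" "x \<in> V \<inter> M" "V \<inter> M \<subseteq> T"
        using basic T by blast
      have "openin X (V \<inter> topspace X)"
        using V(1,2) Z_props(2) by (metis openin_subtopology_Int)
      then show "\<exists>T. openin X T \<and> x \<in> T \<and> T \<subseteq> U"
        using V x T XM by (intro exI[of _ "V \<inter> topspace X"]) auto
    qed
  next
    fix U assume "openin X U"
    then have "openin (subtopology Z0 (topspace X)) U" using Z_props(2)[OF Z0] by simp
    then obtain V where "openin Z0 V" "U = V \<inter> topspace X" by (auto simp: openin_subtopology)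
    then show "openin (subtopology W (topspace X)) U"
      using op_basic[OF Z0] XM unfolding openin_subtopology by (intro exI[of _ "V \<inter> M"]) auto
  qed
  have densW: "W closure_of topspace X = topspace W"
  proof
    show "W closure_of topspace X \<subseteq> topspace W" by (rule closure_of_subset_topspace)
    show "topspace W \<subseteq> W closure_of topspace X"
    proof
      fix x assume x: "x \<in> topspace W"
      have "\<exists>y\<in>topspace X. y \<in> T" if T: "x \<in> T" "openin W T" for T
      proof -
        obtain Z V where V: "Z \<in> C" "openin Z V" "x \<in> V \<inter> M" "V \<inter> M \<subseteq> T"
          using basic T by blast
        then have "x \<in> Z closure_of topspace X" using Z_props(3)[OF V(1)] MZ[OF V(1)] by blast
        then obtain y where "y \<in> topspace X" "y \<in> V" using V by (auto simp: in_closure_of)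
        then show ?thesis using V XM by auto
      qed
      then show "x \<in> W closure_of topspace X" using x by (auto simp: in_closure_of)
    qed
  qed
  let ?K = "\<lambda>Z. topspace Z - topspace X"
  have K_im: "compactin Z (?K Z')" if "Z \<in> C" "Z' \<in> C" "continuous_map Z' Z id" for Z Z'
    using image_compactin[OF Z_props(6)[OF that(2)] that(3)] by simp
  define L where "L = M - topspace X"
  \<comment> \<open>By directedness the members refining a given \<open>Z\<close> already cut the
    remainder down to \<open>L\<close>. Their remainders are compact, hence closed, in
    \<open>Z\<close>, so \<open>L\<close> is compact in every member.\<close>
  have L_eq: "L = (\<Inter>Z'\<in>{Z'\<in>C. continuous_map Z' Z id}. ?K Z')" if "Z \<in> C" for Z
  proof
    show "L \<subseteq> (\<Inter>Z'\<in>{Z'\<in>C. continuous_map Z' Z id}. ?K Z')" by (auto simp: L_def M_def)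
    show "(\<Inter>Z'\<in>{Z'\<in>C. continuous_map Z' Z id}. ?K Z') \<subseteq> L"
    proof
      fix x assume x: "x \<in> (\<Inter>Z'\<in>{Z'\<in>C. continuous_map Z' Z id}. ?K Z')"
      have "x \<in> topspace Z1" if "Z1 \<in> C" for Z1
      proof -
        obtain Z2 where Z2: "Z2 \<in> C" "continuous_map Z2 Z id" "continuous_map Z2 Z1 id"
          using dir \<open>Z \<in> C\<close> \<open>Z1 \<in> C\<close> by blast
        then have "x \<in> topspace Z2" using x by blast
        then show ?thesis using Z2(3) by (auto simp: continuous_map_def)
      qed
      moreover have "x \<notin> topspace X" using x \<open>Z \<in> C\<close> continuous_map_id[of Z] by blast
      ultimately show "x \<in> L" by (auto simp: L_def M_def)
    qed
  qed
  have Lc: "compactin Z L" if "Z \<in> C" for Z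
  proof -
    have "closedin Z L"
      unfolding L_eq[OF that] using that K_im compactin_imp_closedin[OF Z_props(5)[OF that]]
      by (intro closedin_Inter) auto
    moreover have "L \<subseteq> ?K Z" using MZ[OF that] by (auto simp: L_def)
    ultimately show ?thesis using Z_props(6)[OF that] closed_compactin by blast
  qed
  \<comment> \<open>Rigidity of compact Hausdorff topologies: \<open>L\<close> is compact in a
    common refinement \<open>Z2\<close> and \<open>id\<close> into the Hausdorff space
    \<open>Z0\<close> is continuous, so relatively closed subsets of \<open>L\<close> in
    \<open>Z2\<close> are closed in \<open>Z0\<close>. Thus on \<open>L\<close> the topology
    \<open>Z0\<close> is at least as fine as \<open>W\<close>, and compactness of \<open>L\<close>
    passes to \<open>W\<close>.\<close>
  have "continuous_map (subtopology Z0 L) W id"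
    unfolding continuous_map_def
  proof (intro conjI allI impI)
    have tL: "topspace (subtopology Z0 L) = L" using Lc[OF Z0] compactin_subset_topspace by fastforce
    show "id \<in> topspace (subtopology Z0 L) \<rightarrow> topspace W" by (auto simp: tL tW L_def)
    fix T assume T: "openin W T"
    show "openin (subtopology Z0 L) {x \<in> topspace (subtopology Z0 L). id x \<in> T}"
    proof (subst openin_subopen, intro ballI)
      fix x assume x: "x \<in> {x \<in> topspace (subtopology Z0 L). id x \<in> T}"
      then have "x \<in> T" by simp
      then obtain Z V where V: "Z \<in> C" "openin Z V" "x \<in> V \<inter> M" "V \<inter> M \<subseteq> T"
        using basic[OF T] by blast
      obtain Z2 where Z2: "Z2 \<in> C" "continuous_map Z2 Z id" "continuous_map Z2 Z0 id"
        using dir V Z0 by blast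
      have "closedin Z2 (topspace Z2 - V \<inter> topspace Z2)"
        using op_trace[OF Z2(2) V(2)] by blast
      then have "closedin Z2 (topspace Z2 - V)" by (simp add: Diff_Int)
      then have "compactin Z2 ((topspace Z2 - V) \<inter> L)"
        using Lc[OF Z2(1)] by (rule closed_Int_compactin)
      then have "compactin Z0 (id ` ((topspace Z2 - V) \<inter> L))"
        using Z2(3) by (rule image_compactin)
      then have "closedin Z0 ((topspace Z2 - V) \<inter> L)"
        using compactin_imp_closedin[OF Z_props(5)[OF Z0]] by simp
      then have "openin Z0 (topspace Z0 - (topspace Z2 - V) \<inter> L)" by blast
      then have "openin (subtopology Z0 L) ((topspace Z0 - (topspace Z2 - V) \<inter> L) \<inter> L)"
        by (rule openin_subtopology_Int)
      moreover have "(topspace Z0 - (topspace Z2 - V) \<inter> L) \<inter> L = V \<inter> L"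
        using MZ[OF Z0] MZ[OF Z2(1)] by (auto simp: L_def)
      ultimately show "\<exists>S. openin (subtopology Z0 L) S \<and> x \<in> S \<and>
          S \<subseteq> {x \<in> topspace (subtopology Z0 L). id x \<in> T}"
        using V x unfolding tL by (intro exI[of _ "V \<inter> L"]) (auto simp: L_def)
    qed
  qed
  moreover have "compactin (subtopology Z0 L) L"
    using Lc[OF Z0] by (simp add: compactin_subtopology)
  ultimately have LW: "compactin W L"
    using image_compactin[of "subtopology Z0 L" L W id] by simp
  have We: "W \<in> ext_spaces X"
    using XM subW densW CW HW LW
    by (simp add: ext_spaces_def extension_of_def Tychonoff_space_def tW L_def)
  have "P (subtopology X (topspace X - U))" if U: "openin W U" "topspace W - topspace X \<subseteq> U" for U
  proof -
    have LU: "L \<subseteq> U" using U by (simp add: tW L_def)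
    \<comment> \<open>The traces contained in \<open>U\<close> form a directed family, since a union
      of two is a trace from a common refinement. Compactness of \<open>L\<close> in
      \<open>W\<close> therefore yields one \<open>V\<close>, open in one member \<open>Z\<close>,
      with \<open>L \<subseteq> V\<close> and \<open>V \<inter> M \<subseteq> U\<close>.\<close>
    define \<U> where "\<U> = {V \<inter> M |V. V \<inter> M \<subseteq> U \<and> (\<exists>Z\<in>C. openin Z V)}"
    have "\<exists>B\<in>\<U>. L \<subseteq> B"
    proof (rule compactin_directed_cover[OF LW])
      show "openin W B" if "B \<in> \<U>" for B using that op_basic by (auto simp: \<U>_def)
      show "L \<subseteq> \<Union>\<U>"
      proof
        fix x assume "x \<in> L"
        then obtain Z V where "Z \<in> C" "openin Z V" "x \<in> V \<inter> M" "V \<inter> M \<subseteq> U"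
          using basic[OF U(1)] LU by blast
        then show "x \<in> \<Union>\<U>" unfolding \<U>_def by blast
      qed
      have "{} \<inter> M \<in> \<U>"
        unfolding \<U>_def by (rule CollectI, rule exI[of _ "{}"]) (use Z0 in auto)
      then show "\<U> \<noteq> {}" by (metis empty_iff)
      fix B1 B2 assume "B1 \<in> \<U>" "B2 \<in> \<U>"
      then obtain Z1 V1 Z2 V2 where V: "B1 = V1 \<inter> M" "B2 = V2 \<inter> M" "B1 \<subseteq> U" "B2 \<subseteq> U"
         "Z1 \<in> C" "Z2 \<in> C" "openin Z1 V1" "openin Z2 V2"
        unfolding \<U>_def by blast
      then obtain Z where Z: "Z \<in> C" "continuous_map Z Z1 id" "continuous_map Z Z2 id"
        using dir by blast
      let ?V = "(V1 \<inter> topspace Z) \<union> (V2 \<inter> topspace Z)"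
      have "openin Z ?V"
        using op_trace[OF Z(2) V(7)] op_trace[OF Z(3) V(8)] by blast
      moreover have eq: "B1 \<union> B2 = ?V \<inter> M"
        using V(1,2) MZ[OF Z(1)] by auto
      moreover have "?V \<inter> M \<subseteq> U" unfolding eq[symmetric] using V(3,4) by blast
      ultimately have "B1 \<union> B2 \<in> \<U>" using Z(1) unfolding \<U>_def by blast
      then show "\<exists>B\<in>\<U>. B1 \<union> B2 \<subseteq> B" by blast
    qed
    then obtain Z V where V: "Z \<in> C" "openin Z V" "L \<subseteq> V" "V \<inter> M \<subseteq> U"
      unfolding \<U>_def by blast
    \<comment> \<open>The part of the remainder of \<open>Z\<close> outside \<open>V\<close> is
      compact and misses \<open>L\<close>, so the complements of the remainders of refining members
      cover it. One of them suffices, which gives a \<open>Z'\<close> whose whole remainder lies in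
      \<open>V\<close>.\<close>
    define \<V> where "\<V> = {topspace Z - ?K Z' |Z'. Z' \<in> C \<and> continuous_map Z' Z id}"
    have "compactin Z ((topspace Z - V) \<inter> ?K Z)"
      using V Z_props(6)[OF V(1)] by (intro closed_Int_compactin) auto
    moreover have "openin Z B" if B: "B \<in> \<V>" for B
    proof -
      obtain Z' where "Z' \<in> C" "continuous_map Z' Z id" "B = topspace Z - ?K Z'"
        using B unfolding \<V>_def by blast
      then show ?thesis
        using K_im V(1) compactin_imp_closedin[OF Z_props(5)[OF V(1)]] by (metis closedin_def)
    qed
    moreover have "(topspace Z - V) \<inter> ?K Z \<subseteq> \<Union>\<V>"
    proof
      fix x assume x: "x \<in> (topspace Z - V) \<inter> ?K Z"
      then have "x \<notin> L" using V(3) by auto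
      then obtain Z' where "Z' \<in> C" "continuous_map Z' Z id" "x \<notin> ?K Z'"
        unfolding L_eq[OF V(1)] by blast
      then show "x \<in> \<Union>\<V>" using x unfolding \<V>_def by blast
    qed
    moreover have "\<V> \<noteq> {}"
      using V(1) continuous_map_id[of Z] unfolding \<V>_def by blast
    moreover have "\<exists>B\<in>\<V>. B1 \<union> B2 \<subseteq> B" if B: "B1 \<in> \<V>" "B2 \<in> \<V>" for B1 B2
    proof -
      obtain Z1 Z2 where Z12: "Z1 \<in> C" "Z2 \<in> C" "continuous_map Z1 Z id" "continuous_map Z2 Z id"
        "B1 = topspace Z - ?K Z1" "B2 = topspace Z - ?K Z2"
        using B unfolding \<V>_def by blast
      obtain Z3 where Z3: "Z3 \<in> C" "continuous_map Z3 Z1 id" "continuous_map Z3 Z2 id"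
        using dir Z12 by blast
      then have "topspace Z3 \<subseteq> topspace Z1" "topspace Z3 \<subseteq> topspace Z2"
        by (auto simp: continuous_map_def)
      moreover have "continuous_map Z3 Z id"
        using continuous_map_compose[OF Z3(2) Z12(3)] by simp
      ultimately show ?thesis
        using Z3(1) Z12 unfolding \<V>_def by (intro bexI[of _ "topspace Z - ?K Z3"]) auto
    qed
    ultimately have "\<exists>B\<in>\<V>. (topspace Z - V) \<inter> ?K Z \<subseteq> B"
      by (rule compactin_directed_cover)
    then obtain Z' where Z': "Z' \<in> C" "continuous_map Z' Z id"
      and sub: "(topspace Z - V) \<inter> ?K Z \<subseteq> topspace Z - ?K Z'"
      unfolding \<V>_def by blast
    have "topspace Z' \<subseteq> topspace Z" using Z' by (auto simp: continuous_map_def)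
    then have "?K Z' \<subseteq> V \<inter> topspace Z'" using sub by blast
    then have "P (subtopology X (topspace X - V \<inter> topspace Z'))"
      using ext_has_property_iff[OF P ext(1)[OF Z'(1)]] ext(2)[OF Z'(1)] op_trace[OF Z'(2) V(2)] by blast
    moreover have "topspace X - V \<inter> topspace Z' = topspace X - V" using Z_props(1)[OF Z'(1)] by auto
    ultimately have PV: "P (subtopology X (topspace X - V))" by simp
    \<comment> \<open>The criterion for \<open>Z'\<close> gives \<open>P\<close> on the complement
      of \<open>V\<close> in \<open>X\<close>; the complement of \<open>U\<close> is closed in
      it.\<close>
    have sub_UV: "topspace X - U \<subseteq> topspace X - V" using V XM by auto
    have "openin X (U \<inter> topspace X)" using openin_subtopology_Int[OF U(1)] subW by metis
    then have "closedin X (topspace X - U \<inter> topspace X)" by blast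
    moreover have "topspace X - U \<inter> topspace X = topspace X - U" by auto
    ultimately have "closedin (subtopology X (topspace X - V)) (topspace X - U)"
      using sub_UV by (simp add: closedin_subset_topspace)
    then have "P (subtopology (subtopology X (topspace X - V)) (topspace X - U))"
      using closed_hereditary[OF P(1-3) Hausdorff_space_subtopology[OF HX] PV] by blast
    then show ?thesis using sub_UV by (simp add: subtopology_subtopology inf.absorb2)
  qed
  then have "P W" using ext_has_property_iff[OF P We] by blast
  then show thesis using that We cW by (auto simp: prop_ext_spaces_def)
qed

text \<open>Zorn's lemma is applied to the extensions with \<open>P\<close> that map to
  \<open>Y\<close> by \<open>id\<close>. A proper subextension with \<open>P\<close>, or a strictly
  finer topology with \<open>P\<close> on the same points, would be a strictly larger element, so a
  maximal one is optimal.\<close>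

lemma optimal_ext_above:
  assumes Y: "Y \<in> prop_ext_spaces P X"
  obtains Z where "optimal_ext P X Z" "continuous_map Z Y id"
proof -
  define A where "A = {Z \<in> prop_ext_spaces P X. continuous_map Z Y id}"
  let ?le = "\<lambda>S T :: 'u topology. continuous_map T S id"
  have eqI: "S = T" if "continuous_map T S id" "continuous_map S T id" for S T :: "'u topology"
  proof -
    have ts: "topspace S = topspace T" using that by (auto simp: continuous_map_def)
    have "openin T U" if "openin S U" "continuous_map T S id" "topspace S = topspace T" for S T :: "'u topology" and U
    proof -
      have "{x \<in> topspace T. id x \<in> U} = U" using that openin_subset by fastforce
      then show ?thesis using openin_continuous_map_preimage[OF that(2,1)] by simp
    qed
    then show ?thesis using that ts unfolding topology_eq by metis
  qed
  have "partial_order_on A (relation_of ?le A)"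
    unfolding partial_order_on_def preorder_on_def
  proof (intro conjI)
    show "relation_of ?le A \<subseteq> A \<times> A" by (auto simp: relation_of_def)
    show "refl_on A (relation_of ?le A)" by (auto simp: refl_on_def relation_of_def)
    show "trans (relation_of ?le A)"
    proof (rule transI)
      fix R S T assume "(R, S) \<in> relation_of ?le A" "(S, T) \<in> relation_of ?le A"
      then have "R \<in> A" "T \<in> A" "continuous_map T S id" "continuous_map S R id"
        by (auto simp: relation_of_def)
      then show "(R, T) \<in> relation_of ?le A"
        using continuous_map_compose[of T S id R id] by (simp add: relation_of_def)
    qed
    show "antisym (relation_of ?le A)" using eqI by (auto simp: antisym_def relation_of_def)
  qed
  moreover have "\<exists>u\<in>A. \<forall>a\<in>C. ?le a u" if C: "C \<in> Chains (relation_of ?le A)" for C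
  proof (cases "C = {}")
    case True
    then show ?thesis using Y by (auto simp: A_def)
  next
    case False
    have CA: "C \<subseteq> A" using Chains_relation_of[OF C] .
    have "continuous_map S T id \<or> continuous_map T S id" if "S \<in> C" "T \<in> C" for S T
      using C that unfolding Chains_def relation_of_def by blast
    then obtain W where W: "W \<in> prop_ext_spaces P X" "\<And>Z. Z \<in> C \<Longrightarrow> continuous_map W Z id"
      using prop_ext_spaces_chain_bound[of C X] CA False unfolding A_def by blast
    obtain Z where "Z \<in> C" using False by auto
    then have "continuous_map W Y (id \<circ> id)"
      using W(2) CA unfolding A_def by (blast intro: continuous_map_compose)
    then show ?thesis using W by (auto simp: A_def)
  qed
  ultimately obtain Z where Z: "Z \<in> A" and max: "\<And>T. T \<in> A \<Longrightarrow> continuous_map T Z id \<Longrightarrow> T = Z"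
    using predicate_Zorn[of A ?le] by blast
  have ZP: "Z \<in> prop_ext_spaces P X" "continuous_map Z Y id" using Z by (auto simp: A_def)
  \<comment> \<open>Maximality within \<open>A\<close> extends to all extensions with
    \<open>P\<close>, because whatever maps to \<open>Z\<close> by \<open>id\<close> also maps to
    \<open>Y\<close> and so belongs to \<open>A\<close>.\<close>
  have max': "T = Z" if "T \<in> prop_ext_spaces P X" "continuous_map T Z id" for T
    using max that continuous_map_compose[OF that(2) ZP(2)] by (simp add: A_def)
  have "minimal_ext P X Z"
    unfolding minimal_ext_def
  proof (intro conjI notI)
    assume "\<exists>T\<in>prop_ext_spaces P X. topspace T \<subset> topspace Z \<and> subtopology Z (topspace T) = T"
    then obtain T where T: "T \<in> prop_ext_spaces P X" "topspace T \<subset> topspace Z"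
      "subtopology Z (topspace T) = T" by blast
    have "continuous_map T Z id" using T(3) by (metis continuous_map_id_subt)
    then show False using max' T by blast
  qed fact
  moreover have False if T: "T \<in> prop_ext_spaces P X" "topspace T = topspace Z"
    "{U. openin Z U} \<subset> {U. openin T U}" for T
  proof -
    have "continuous_map T Z id"
      unfolding continuous_map_def
    proof (intro conjI allI impI)
      fix U assume U: "openin Z U"
      then have "{x \<in> topspace T. id x \<in> U} = U" using T(2) openin_subset by fastforce
      then show "openin T {x \<in> topspace T. id x \<in> U}" using U T(3) by auto
    qed (use T in auto)
    then show False using max' T by blast
  qed
  ultimately have "optimal_ext P X Z" by (auto simp: optimal_ext_def)
  then show thesis using that ZP by blast
qed

end

section \<open>Order-theoretic descriptions of the optimal extensions\<close>

theorem theorem4p4: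
  fixes P Q :: "'u topology \<Rightarrow> bool" and X :: "'u topology"
  assumes "compactness_like_pair P Q"
    and "Tychonoff_space X" and "Q X"
  shows
    "(optimal_exts2 P Q X = {Y. maximal_in (le_inj X) (prop_exts2 P Q X) Y})
     \<and>
     (cofinal_in (le_inj X) (prop_exts2 P Q X) (optimal_exts2 P Q X) \<and>
      (\<forall>\<E>. cofinal_in (le_inj X) (prop_exts2 P Q X) \<E> \<longrightarrow> optimal_exts2 P Q X \<subseteq> \<E>))
     \<and>
     (cofinal_in (le_inj X) (prop_exts2 P Q X) (optimal_exts2 P Q X) \<and>
      (\<forall>S\<in>optimal_exts2 P Q X. \<forall>T\<in>optimal_exts2 P Q X. le_inj X S T \<longleftrightarrow> S = T) \<and>
      (\<forall>\<E>. cofinal_in (le_inj X) (prop_exts2 P Q X) \<E> \<and>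
            (\<forall>S\<in>\<E>. \<forall>T\<in>\<E>. le_inj X S T \<longleftrightarrow> S = T) \<longrightarrow> \<E> = optimal_exts2 P Q X))
     \<and>
     (optimal_exts2 P Q X \<subseteq> prop_exts2 P Q X \<and>
      (\<forall>S\<in>optimal_exts2 P Q X. \<forall>T\<in>prop_exts2 P Q X. le_inj X S T \<longrightarrow> S = T) \<and>
      (\<forall>\<E>. \<E> \<subseteq> prop_exts2 P Q X \<and>
            (\<forall>S\<in>\<E>. \<forall>T\<in>prop_exts2 P Q X. le_inj X S T \<longrightarrow> S = T) \<longrightarrow>
            \<E> \<subseteq> optimal_exts2 P Q X))"
proof -
  have P: "topological_property P" "clopen_hereditary P" "perfect_inverse_invariant P" "Mrowka_W P"
    and Q: "topological_property Q" "clopen_hereditary Q" "perfect_inverse_invariant Q" "Mrowka_W Q"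
    using assms(1) by (auto simp: compactness_like_pair_def compactness_like_def perfect_property_def)
  have HX: "Hausdorff_space X" using assms(2) by (simp add: Tychonoff_space_def)
  have QY: "Q Y" if Y: "Y \<in> ext_spaces X" for Y
  proof -
    have subX: "subtopology Y (topspace X) = X"
      using Y by (simp add: ext_spaces_def extension_of_def)
    have "Q (subtopology X (topspace X - U))" if U: "openin Y U" for U
    proof -
      have "openin X (U \<inter> topspace X)" using openin_subtopology_Int[OF U] subX by metis
      then have "closedin X (topspace X - U \<inter> topspace X)" by blast
      then have "closedin X (topspace X - U)" by (simp add: Diff_Int)
      then show ?thesis by (rule closed_hereditary[OF Q(1-3) HX assms(3)])
    qed
    then show ?thesis using ext_has_property_iff[OF Q Y] by blast
  qed
  have "prop_ext_spaces P X \<subseteq> prop_ext_spaces Q X"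
    using QY by (auto simp: prop_ext_spaces_def)
  then have PQ: "prop_exts P X \<subseteq> prop_exts Q X"
    by (auto simp: prop_exts_def quotient_def)
  have opt_prop: "optimal_ext P X Y \<Longrightarrow> Y \<in> prop_ext_spaces P X" for Y
    by (simp add: optimal_ext_def minimal_ext_def)
  then have OP: "optimal_exts P X \<subseteq> prop_exts P X"
    by (auto simp: optimal_exts_def prop_exts_def quotient_def)
  let ?E = "prop_exts P X" and ?O = "optimal_exts P X"
  \<comment> \<open>Every space in \<open>ext_spaces X\<close> inherits \<open>Q\<close> from
    \<open>X\<close>, so intersecting with \<open>prop_exts Q X\<close> removes nothing.\<close>
  have E: "prop_exts2 P Q X = ?E" and O: "optimal_exts2 P Q X = ?O"
    using PQ OP by (auto simp: prop_exts2_def optimal_exts2_def)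
  have ext: "Y \<in> prop_ext_spaces P X \<Longrightarrow> extension_of X Y" for Y
    by (simp add: prop_ext_spaces_def ext_spaces_def)
  \<comment> \<open>On representatives, an injection over \<open>X\<close> into an optimal extension
    is a homeomorphism over \<open>X\<close>, which for classes means equality.\<close>
  have antichain: "S = T" if "S \<in> ?O" "T \<in> ?E" "le_inj X S T" for S T
  proof -
    obtain Y where Y: "optimal_ext P X Y" "S = ext_rel X `` {Y}"
      using \<open>S \<in> ?O\<close> by (auto simp: optimal_exts_def elim: quotientE)
    obtain Y' where Y': "Y' \<in> prop_ext_spaces P X" "T = ext_rel X `` {Y'}"
      using \<open>T \<in> ?E\<close> by (auto simp: prop_exts_def elim: quotientE)
    have e: "extension_of X Y" "extension_of X Y'" using ext opt_prop Y Y' by blast+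
    have "le_inj_space X Y Y'" using that(3) le_inj_class_iff[OF e] Y(2) Y'(2) by simp
    then obtain f where "continuous_map Y' Y f" "inj_on f (topspace Y')" "\<forall>x\<in>topspace X. f x = x"
      by (auto simp: le_inj_space_def)
    moreover from this have "homeomorphic_map Y' Y f"
      using optimal_ext_le_inj_imp_homeomorphic[OF P Y(1) Y'(1)] by blast
    ultimately have "(Y', Y) \<in> ext_rel X" using e by (auto simp: ext_rel_def)
    then show ?thesis using equiv_class_eq[OF equiv_ext_rel] Y(2) Y'(2) by metis
  qed
  have cof: "\<exists>T\<in>?O. le_inj X S T" if S: "S \<in> ?E" for S
  proof -
    obtain Y where Y: "Y \<in> prop_ext_spaces P X" "S = ext_rel X `` {Y}"
      using S by (auto simp: prop_exts_def elim: quotientE)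
    obtain Z where Z: "optimal_ext P X Z" "continuous_map Z Y id"
      using optimal_ext_above[OF P Y(1)] by blast
    have "le_inj_space X Y Z" using Z(2) by (auto simp: le_inj_space_def)
    then have "le_inj X S (ext_rel X `` {Z})"
      using le_inj_class_iff ext opt_prop Y Z(1) by blast
    moreover have "ext_rel X `` {Z} \<in> ?O" using Z(1) by (auto simp: optimal_exts_def intro: quotientI)
    ultimately show ?thesis by blast
  qed
  have refl: "le_inj X S S" if S: "S \<in> ?E" for S
  proof -
    obtain Y where Y: "Y \<in> prop_ext_spaces P X" "S = ext_rel X `` {Y}"
      using S by (auto simp: prop_exts_def elim: quotientE)
    have "le_inj_space X Y Y" by (auto simp: le_inj_space_def intro!: exI[of _ id])
    then show ?thesis using le_inj_class_iff ext Y by blast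
  qed
  have C: "cofinal_in (le_inj X) ?E ?O" using OP cof by (simp add: cofinal_in_def)
  \<comment> \<open>All claims now follow formally from three facts: nothing in \<open>?E\<close>
    lies strictly above an element of \<open>?O\<close> (\<open>antichain\<close>), every element of
    \<open>?E\<close> lies below one of \<open>?O\<close> (\<open>cof\<close>), and
    \<open>le_inj X\<close> is reflexive on \<open>?E\<close> (\<open>refl\<close>).\<close>
  have 1: "?O = {Y. maximal_in (le_inj X) ?E Y}"
  proof
    show "?O \<subseteq> {Y. maximal_in (le_inj X) ?E Y}"
    proof
      fix S assume S: "S \<in> ?O"
      have "T = S" if "T \<in> ?E" "le_inj X S T" for T using antichain[OF S that] by simp
      then show "S \<in> {Y. maximal_in (le_inj X) ?E Y}" using S OP by (auto simp: maximal_in_def)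
    qed
    show "{Y. maximal_in (le_inj X) ?E Y} \<subseteq> ?O"
    proof
      fix S assume "S \<in> {Y. maximal_in (le_inj X) ?E Y}"
      then have S: "S \<in> ?E" "\<And>T. T \<in> ?E \<Longrightarrow> le_inj X S T \<Longrightarrow> T = S"
        by (auto simp: maximal_in_def)
      obtain T where "T \<in> ?O" "le_inj X S T" using cof[OF S(1)] by blast
      then show "S \<in> ?O" using S(2)[of T] OP by blast
    qed
  qed
  have 2: "?O \<subseteq> \<E>" if \<E>: "cofinal_in (le_inj X) ?E \<E>" for \<E>
  proof
    fix S assume S: "S \<in> ?O"
    then obtain T where T: "T \<in> \<E>" "le_inj X S T" "T \<in> ?E"
      using \<E> OP unfolding cofinal_in_def by blast
    show "S \<in> \<E>" using antichain[OF S T(3,2)] T(1) by simp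
  qed
  \<comment> \<open>Cofinality puts \<open>?O\<close> inside \<open>\<E>\<close>; hence the optimal
    class above a member of \<open>\<E>\<close> is itself in \<open>\<E>\<close>, where
    \<open>le_inj X\<close> means equality.\<close>
  have 3: "\<E> = ?O" if \<E>: "cofinal_in (le_inj X) ?E \<E> \<and> (\<forall>S\<in>\<E>. \<forall>T\<in>\<E>. le_inj X S T \<longleftrightarrow> S = T)" for \<E>
  proof
    show O\<E>: "?O \<subseteq> \<E>" using 2 \<E> by simp
    show "\<E> \<subseteq> ?O"
    proof
      fix S assume S: "S \<in> \<E>"
      then have "S \<in> ?E" using \<E> by (auto simp: cofinal_in_def)
      then obtain T where T: "T \<in> ?O" "le_inj X S T" using cof by blast
      then have "S = T" using \<E> S O\<E> by blast
      then show "S \<in> ?O" using T(1) by simp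
    qed
  qed
  have 4: "\<E> \<subseteq> ?O" if \<E>: "\<E> \<subseteq> ?E \<and> (\<forall>S\<in>\<E>. \<forall>T\<in>?E. le_inj X S T \<longrightarrow> S = T)" for \<E>
  proof
    fix S assume S: "S \<in> \<E>"
    then have "S \<in> ?E" using \<E> by blast
    then obtain T where T: "T \<in> ?O" "le_inj X S T" using cof by blast
    then have "S = T" using \<E> S OP by blast
    then show "S \<in> ?O" using T(1) by simp
  qed
  have 5: "le_inj X S T \<longleftrightarrow> S = T" if "S \<in> ?O" "T \<in> ?O" for S T
    using antichain[OF that(1)] refl OP that by blast
  show ?thesis
    unfolding E O
  proof (intro conjI)
    show "\<forall>\<E>. cofinal_in (le_inj X) ?E \<E> \<longrightarrow> ?O \<subseteq> \<E>"
      by (intro allI impI) (rule 2)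
    show "\<forall>\<E>. cofinal_in (le_inj X) ?E \<E> \<and> (\<forall>S\<in>\<E>. \<forall>T\<in>\<E>. le_inj X S T \<longleftrightarrow> S = T) \<longrightarrow> \<E> = ?O"
      by (intro allI impI) (rule 3)
    show "\<forall>\<E>. \<E> \<subseteq> ?E \<and> (\<forall>S\<in>\<E>. \<forall>T\<in>?E. le_inj X S T \<longrightarrow> S = T) \<longrightarrow> \<E> \<subseteq> ?O"
      by (intro allI impI) (rule 4)
    show "\<forall>S\<in>?O. \<forall>T\<in>?O. le_inj X S T \<longleftrightarrow> S = T"
      by (intro ballI) (rule 5)
    show "\<forall>S\<in>?O. \<forall>T\<in>?E. le_inj X S T \<longrightarrow> S = T"
      by (intro ballI impI) (rule antichain)
  qed (fact 1 C OP)+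
qed

end
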